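(* There exists an arc-connected, geometrically doubling metric measure space $(X,d,\mu)$ such that $X\subset\mathbb{R}^2$, $d$ is the restriction to $X$ of the distance defined by the $\ell_\infty$-norm on $\mathbb{R}^2$, and $\mu$ satisfies a local comparability condition but is not doubling.
   Context: $B(x,r)=\{y\in X: d(x,y)<r\}$ denotes the open ball. The $\ell_\infty$ distance on $\mathbb{R}^2$ is $\max\{|a-c|,|b-d|\}$ between $(a,b)$ and $(c,d)$. A metric measure space $(X,d,\mu)$ is a metric space $(X,d)$ with a Borel measure $\mu$, not identically zero, such that $\mu(B(x,r))<\infty$ for all balls and $\mu$ is $\tau$-smooth: for every collection $\{U_\alpha\}_{\alpha\in\Lambda}$ of open sets, $\mu(\bigcup_\alpha U_\alpha)=\sup\mu(\bigcup_{i=1}^n U_{\alpha_i})$, the supremum being over all finite subcollections (this is automatic in separable spaces). $\mu$ satisfies a local comparability condition if there is a constant $C\in[1,\infty)$ such that for all $r>0$ and all $x,y\in X$ with $d(x,y)<r$, $\mu(B(x,r))\le C\mu(B(y,r))$. $(X,d)$ is geometrically doubling if there is a positive integer $D$ such that every ball of radius $r$ can be covered with no more than $D$ balls of radius $r/2$. $\mu$ is doubling if there is $C>0$ such that for all $r>0$ and all $x\in X$, $\mu(B(x,2r))\le C\mu(B(x,r))<\infty$. *)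

theory Defs
  imports "HOL-Analysis.Analysis"
begin

text \<open>The library's \<open>Metric_space\<close> is used relative to an explicit carrier \<open>X\<close>: balls \<open>mball\<close>
  and the topology \<open>mtopology\<close> are those of \<open>X\<close> itself, and a distance given on the whole type
  enters only through its restriction to \<open>X\<close>.\<close>

context Metric_space
begin

definition arc_connected :: bool where
  "arc_connected \<longleftrightarrow>
     (\<forall>x\<in>M. \<forall>y\<in>M. x \<noteq> y \<longrightarrow>
        (\<exists>g. embedding_map (top_of_set {0..1::real}) mtopology g \<and> g 0 = x \<and> g 1 = y))"

definition geometrically_doubling :: bool where
  "geometrically_doubling \<longleftrightarrow>
     (\<exists>D::nat. D > 0 \<and>
        (\<forall>x\<in>M. \<forall>r>0. \<exists>C\<subseteq>M. finite C \<and> card C \<le> D \<and> mball x r \<subseteq> (\<Union>c\<in>C. mball c (r / 2))))"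

end

text \<open>Borel measures are allowed to take the value \<open>\<infinity>\<close>, but not on balls. The last assumption is
  \<open>\<tau>\<close>-smoothness.\<close>

locale metric_measure_space = Metric_space X d
  for X :: "'a set" and d :: "'a \<Rightarrow> 'a \<Rightarrow> real" +
  fixes \<mu> :: "'a measure"
  assumes space_eq: "space \<mu> = X"
    and sets_eq: "sets \<mu> = sigma_sets X {U. openin mtopology U}"
    and not_zero: "emeasure \<mu> X \<noteq> 0"
    and ball_finite: "\<And>x r. x \<in> X \<Longrightarrow> r > 0 \<Longrightarrow> emeasure \<mu> (mball x r) < \<infinity>"
    and tau_smooth: "\<And>\<U>. (\<And>U. U \<in> \<U> \<Longrightarrow> openin mtopology U) \<Longrightarrow>
          emeasure \<mu> (\<Union>\<U>) = (SUP \<F> \<in> {\<F>. \<F> \<subseteq> \<U> \<and> finite \<F>}. emeasure \<mu> (\<Union>\<F>))"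
begin

definition local_comparability :: bool where
  "local_comparability \<longleftrightarrow>
     (\<exists>C::real. C \<ge> 1 \<and>
        (\<forall>r>0. \<forall>x\<in>X. \<forall>y\<in>X. d x y < r \<longrightarrow>
           emeasure \<mu> (mball x r) \<le> ennreal C * emeasure \<mu> (mball y r)))"

definition doubling :: bool where
  "doubling \<longleftrightarrow>
     (\<exists>C::real. C > 0 \<and>
        (\<forall>r>0. \<forall>x\<in>X.
           emeasure \<mu> (mball x (2 * r)) \<le> ennreal C * emeasure \<mu> (mball x r) \<and>
           ennreal C * emeasure \<mu> (mball x r) < \<infinity>))"

end

definition linf_dist :: "real \<times> real \<Rightarrow> real \<times> real \<Rightarrow> real" where
  "linf_dist p q = max \<bar>fst p - fst q\<bar> \<bar>snd p - snd q\<bar>"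

lemma linf_dist_eq_infnorm: "linf_dist p q = infnorm (p - q)"
proof -
  have "(\<lambda>b. \<bar>(p - q) \<bullet> b\<bar>) ` Basis = {\<bar>fst p - fst q\<bar>, \<bar>snd p - snd q\<bar>}"
    by (cases p; cases q) (simp add: Basis_prod_def image_Un insert_commute)
  then show ?thesis
    by (simp add: linf_dist_def infnorm_Max)
qed

end

theory Submission
  imports Defs
begin

text \<open>The space is a V whose two arms become parallel vertical rays at distance 2 from height 1 on.
  The right ray carries Lebesgue measure and the left ray the density \<open>exp (- height)\<close>. A ball
  of radius at most 2 centred high up on one ray does not see the other ray, and on each ray the
  density is comparable at scale 2. A ball of radius \<open>r > 2\<close> contains a piece of the right ray of
  length at least \<open>r\<close>, so its measure is comparable to \<open>r\<close>. Thus local comparability holds, but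
  high up on the left ray passing from radius 2 to radius 4 increases the measure by an
  arbitrarily large factor.\<close>

section \<open>Tau-smoothness and density bounds\<close>

text \<open>Lindelof is applied on the second countable parameter space, to the preimages. A
  countable subfamily then carries the whole union, and continuity from below along its finite
  unions gives the supremum.\<close>

lemma emeasure_Union_open_vimage:
  fixes f :: "'b :: second_countable_topology \<Rightarrow> 'a"
  assumes sets: "\<And>U. U \<in> \<U> \<Longrightarrow> U \<in> sets M"
    and "open": "\<And>U. U \<in> \<U> \<Longrightarrow> open (f -` U)"
    and range: "\<And>U. U \<in> \<U> \<Longrightarrow> U \<subseteq> range f"
  shows "emeasure M (\<Union>\<U>) = (SUP \<F> \<in> {\<F>. \<F> \<subseteq> \<U> \<and> finite \<F>}. emeasure M (\<Union>\<F>))"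
proof -
  obtain \<C> where \<C>: "\<C> \<subseteq> (\<lambda>U. f -` U) ` \<U>" "countable \<C>" "\<Union>\<C> = (\<Union>U\<in>\<U>. f -` U)"
    using Lindelof[of "(\<lambda>U. f -` U) ` \<U>"] "open" by auto
  obtain \<V> where \<V>: "countable \<V>" "\<V> \<subseteq> \<U>" "\<C> = (\<lambda>U. f -` U) ` \<V>"
    using \<C> by (meson countable_subset_image)
  \<comment> \<open>Equal preimages give equal unions only because every set lies in
    \<open>range f\<close>.\<close>
  have "\<Union>\<U> \<subseteq> \<Union>\<V>"
  proof
    fix y assume y: "y \<in> \<Union>\<U>"
    then obtain t where t: "y = f t" using range by blast
    with y have "t \<in> (\<Union>U\<in>\<U>. f -` U)" by auto
    then have "t \<in> (\<Union>U\<in>\<V>. f -` U)" using \<C>(3) \<V>(3) by blast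
    with t show "y \<in> \<Union>\<V>" by auto
  qed
  then have Union_eq: "\<Union>\<U> = \<Union>\<V>" using \<V>(2) by blast
  have Union_sets: "\<Union>\<U> \<in> sets M"
    unfolding Union_eq using \<V> sets by (intro sets.countable_Union) auto
  show ?thesis
  proof (rule antisym)
    show "emeasure M (\<Union>\<U>) \<le> (SUP \<F> \<in> {\<F>. \<F> \<subseteq> \<U> \<and> finite \<F>}. emeasure M (\<Union>\<F>))"
    \<comment> \<open>\<open>from_nat_into\<close> enumerates nonempty sets only; the empty union
      has measure 0.\<close>
    proof (cases "\<V> = {}")
      case True
      then show ?thesis by (simp add: Union_eq)
    next
      case False
      define A where "A n = \<Union>(from_nat_into \<V> ` {..n})" for n
      have in_\<U>: "from_nat_into \<V> n \<in> \<U>" for n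
        using from_nat_into[OF False] \<V>(2) by blast
      have "(\<Union>n. A n) = \<Union>(range (from_nat_into \<V>))"
        unfolding A_def by blast
      then have "\<Union>\<V> = (\<Union>n. A n)"
        by (simp add: range_from_nat_into[OF False \<V>(1)])
      moreover have "incseq A"
        unfolding A_def incseq_def by (intro allI impI Union_mono image_mono) auto
      moreover have "range A \<subseteq> sets M"
        unfolding A_def using sets in_\<U> by (intro image_subsetI sets.finite_Union) auto
      ultimately have "emeasure M (\<Union>\<U>) = (SUP n. emeasure M (A n))"
        unfolding Union_eq by (simp add: SUP_emeasure_incseq)
      also have "\<dots> \<le> (SUP \<F> \<in> {\<F>. \<F> \<subseteq> \<U> \<and> finite \<F>}. emeasure M (\<Union>\<F>))"
      proof (rule SUP_least)
        fix n
        show "emeasure M (A n) \<le> (SUP \<F> \<in> {\<F>. \<F> \<subseteq> \<U> \<and> finite \<F>}. emeasure M (\<Union>\<F>))"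
          unfolding A_def using in_\<U> by (intro SUP_upper) auto
      qed
      finally show ?thesis .
    qed
    show "(SUP \<F> \<in> {\<F>. \<F> \<subseteq> \<U> \<and> finite \<F>}. emeasure M (\<Union>\<F>)) \<le> emeasure M (\<Union>\<U>)"
      by (rule SUP_least) (auto intro!: emeasure_mono Union_sets)
  qed
qed

lemma emeasure_density_le:
  assumes "f \<in> borel_measurable M" "A \<in> sets M" "\<And>x. x \<in> A \<Longrightarrow> f x \<le> c"
  shows "emeasure (density M f) A \<le> c * emeasure M A"
proof -
  have "emeasure (density M f) A \<le> (\<integral>\<^sup>+ x. c * indicator A x \<partial>M)"
    unfolding emeasure_density[OF assms(1,2)]
    by (intro nn_integral_mono) (auto simp: indicator_def assms(3))
  then show ?thesis using assms(2) by (simp add: nn_integral_cmult_indicator)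
qed

lemma emeasure_density_ge:
  assumes "f \<in> borel_measurable M" "A \<in> sets M" "\<And>x. x \<in> A \<Longrightarrow> c \<le> f x"
  shows "c * emeasure M A \<le> emeasure (density M f) A"
proof -
  have "(\<integral>\<^sup>+ x. c * indicator A x \<partial>M) \<le> emeasure (density M f) A"
    unfolding emeasure_density[OF assms(1,2)]
    by (intro nn_integral_mono) (auto simp: indicator_def assms(3))
  then show ?thesis using assms(2) by (simp add: nn_integral_cmult_indicator)
qed

section \<open>The V-shaped space and its measure\<close>

text \<open>The whole space is parametrized by one real: \<open>\<bar>t\<bar>\<close> is the height,
  the sign of \<open>t\<close> selects the arm, and clamping the first coordinate makes the arms
  vertical from height 1 on.\<close>

definition vee :: "real \<Rightarrow> real \<times> real" where
  "vee t = (max (-1) (min 1 t), \<bar>t\<bar>)"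

definition weight :: "real \<Rightarrow> real" where
  "weight t = exp (min t 0)"

definition weight_measure :: "real measure" where
  "weight_measure = density lborel (\<lambda>t. ennreal (weight t))"

text \<open>Balls pulled back to the parameter line, where Lebesgue measure is available. Such a set
  need not be an interval: it may have a component on each arm.\<close>

definition vee_ball :: "real \<Rightarrow> real \<Rightarrow> real set" where
  "vee_ball s r = {t. linf_dist (vee s) (vee t) < r}"

interpretation vee: Metric_space "range vee" linf_dist
  by unfold_locales (auto simp: linf_dist_def prod_eq_iff)

text \<open>A push-forward, taken to the sigma-algebra generated by the open sets of the curve
  itself, so that the carrier is \<open>range vee\<close> and not the plane.\<close>

definition vee_measure :: "(real \<times> real) measure" where
  "vee_measure = distr weight_measure (sigma (range vee) {U. openin vee.mtopology U}) vee"

text \<open>Both coordinates of \<open>vee\<close> are 1-Lipschitz.\<close>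

lemma linf_dist_vee_le: "linf_dist (vee s) (vee t) \<le> \<bar>s - t\<bar>"
  by (auto simp: linf_dist_def vee_def)

lemma linf_dist_vee_ge: "\<bar>\<bar>s\<bar> - \<bar>t\<bar>\<bar> \<le> linf_dist (vee s) (vee t)"
  by (auto simp: linf_dist_def vee_def)

text \<open>First coordinates differ by at most 2, so beyond radius 2 only heights matter and both
  arms look alike.\<close>

lemma linf_dist_vee_large: "2 < r \<Longrightarrow> linf_dist (vee s) (vee t) < r \<longleftrightarrow> \<bar>\<bar>s\<bar> - \<bar>t\<bar>\<bar> < r"
  unfolding linf_dist_def vee_def fst_conv snd_conv max_less_iff_conj by (simp add: abs_less_iff; linarith)

text \<open>The height determines \<open>\<bar>t\<bar>\<close> and the first coordinate determines
  the sign.\<close>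

lemma inj_vee: "inj vee"
  by (rule injI) (auto simp: vee_def max_def min_def split: if_splits)

lemma vimage_mball: "vee -` vee.mball (vee s) r = vee_ball s r"
  by (auto simp: vee_ball_def)

lemma open_vimage_vee:
  assumes "openin vee.mtopology U"
  shows "open (vee -` U)"
  unfolding open_dist
proof
  fix t assume "t \<in> vee -` U"
  then obtain r where r: "r > 0" "vee.mball (vee t) r \<subseteq> U"
    using assms unfolding vee.openin_mtopology by blast
  have "s \<in> vee -` U" if "dist s t < r" for s
    using r(2) that linf_dist_vee_le[of t s] by (force simp: dist_real_def)
  with r(1) show "\<exists>e>0. \<forall>y. dist y t < e \<longrightarrow> y \<in> vee -` U" by blast
qed

lemma openin_subset_Pow: "{U. openin vee.mtopology U} \<subseteq> Pow (range vee)"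
  using openin_subset by fastforce

lemma sets_vee_measure: "sets vee_measure = sigma_sets (range vee) {U. openin vee.mtopology U}"
  by (simp add: vee_measure_def sets_measure_of[OF openin_subset_Pow])

lemma space_vee_measure: "space vee_measure = range vee"
  by (simp add: vee_measure_def space_measure_of[OF openin_subset_Pow])

lemma openin_sets_vee_measure: "openin vee.mtopology U \<Longrightarrow> U \<in> sets vee_measure"
  by (simp add: sets_vee_measure sigma_sets.Basic)

lemma measurable_vee:
  "vee \<in> measurable weight_measure (sigma (range vee) {U. openin vee.mtopology U})"
  by (rule measurable_measure_of[OF openin_subset_Pow])
    (auto simp: weight_measure_def intro!: borel_open open_vimage_vee)

lemma emeasure_vee_measure_openin:
  "openin vee.mtopology U \<Longrightarrow> emeasure vee_measure U = emeasure weight_measure (vee -` U)"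
  unfolding vee_measure_def
  by (subst emeasure_distr[OF measurable_vee])
    (auto simp: sets_measure_of[OF openin_subset_Pow] weight_measure_def intro: sigma_sets.Basic)

lemma emeasure_mball_vee:
  "emeasure vee_measure (vee.mball (vee s) r) = emeasure weight_measure (vee_ball s r)"
  by (simp only: emeasure_vee_measure_openin[OF vee.openin_mball] vimage_mball)

lemma sets_vee_ball: "vee_ball s r \<in> sets lborel"
  using open_vimage_vee[OF vee.openin_mball[of "vee s" r]] unfolding vimage_mball by simp

section \<open>Weight estimates and measures of balls\<close>

lemma weight_measurable: "(\<lambda>t. ennreal (weight t)) \<in> borel_measurable lborel"
  unfolding weight_def by measurable

lemma weight_pos: "weight t > 0" and weight_le_1: "weight t \<le> 1"
  by (auto simp: weight_def)

text \<open>The exponent \<open>min t 0\<close> is 1-Lipschitz in \<open>t\<close>.\<close>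

lemma weight_le_exp: "weight t \<le> exp \<bar>s - t\<bar> * weight s"
  by (auto simp: weight_def simp flip: exp_add)

lemma weight_le_near:
  assumes "t \<in> vee_ball s r" "r \<le> 2"
  shows "weight t \<le> exp 3 * weight s"
proof -
  \<comment> \<open>If \<open>s < -3\<close>, then \<open>\<bar>t\<bar> > 1\<close>, and
    \<open>t\<close> cannot lie on the right ray, which is at distance 2 while the ball is open with
    radius at most 2. Hence \<open>s\<close> and \<open>t\<close> share the left ray and
    \<open>\<bar>s - t\<bar> < 2\<close>.\<close>
  consider "\<bar>s - t\<bar> \<le> 3" | "s \<ge> -3"
    using assms unfolding vee_ball_def linf_dist_def vee_def
    by (auto simp: max_def min_def abs_if split: if_splits)
  then show ?thesis
  proof cases
    case 1
    have "weight t \<le> exp \<bar>s - t\<bar> * weight s" by (rule weight_le_exp)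
    also have "\<dots> \<le> exp 3 * weight s" using 1 weight_pos[of s] by (intro mult_right_mono) auto
    finally show ?thesis .
  next
    case 2
    \<comment> \<open>Here \<open>weight s\<close> is at least \<open>exp (-3)\<close>, whereas no
      weight exceeds 1.\<close>
    then have "1 \<le> exp 3 * weight s" by (auto simp: weight_def simp flip: exp_add)
    with weight_le_1[of t] show ?thesis by linarith
  qed
qed

lemma emeasure_lborel_vee_ball_le:
  assumes "r > 0"
  shows "emeasure lborel (vee_ball s r) \<le> ennreal (4 * r)"
proof -
  \<comment> \<open>Heights in the ball are within \<open>r\<close> of \<open>\<bar>s\<bar>\<close>;
    each sign of \<open>t\<close> contributes one interval of length \<open>2 * r\<close>.\<close>
  have "vee_ball s r \<subseteq> {\<bar>s\<bar> - r..\<bar>s\<bar> + r} \<union> {- \<bar>s\<bar> - r..- \<bar>s\<bar> + r}"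
  proof
    fix t assume "t \<in> vee_ball s r"
    then have "\<bar>\<bar>s\<bar> - \<bar>t\<bar>\<bar> < r" using linf_dist_vee_ge[of s t] by (simp add: vee_ball_def)
    then show "t \<in> {\<bar>s\<bar> - r..\<bar>s\<bar> + r} \<union> {- \<bar>s\<bar> - r..- \<bar>s\<bar> + r}" by auto
  qed
  then have "emeasure lborel (vee_ball s r) \<le>
      emeasure lborel ({\<bar>s\<bar> - r..\<bar>s\<bar> + r} \<union> {- \<bar>s\<bar> - r..- \<bar>s\<bar> + r})"
    by (intro emeasure_mono) auto
  also have "\<dots> \<le> emeasure lborel {\<bar>s\<bar> - r..\<bar>s\<bar> + r} + emeasure lborel {- \<bar>s\<bar> - r..- \<bar>s\<bar> + r}"
    by (intro emeasure_subadditive) auto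
  also have "\<dots> = ennreal (4 * r)"
    using assms by (simp flip: ennreal_plus)
  finally show ?thesis .
qed

lemma emeasure_vee_ball_le:
  assumes "r > 0" "c \<ge> 0" "\<And>t. t \<in> vee_ball s r \<Longrightarrow> weight t \<le> c"
  shows "emeasure weight_measure (vee_ball s r) \<le> ennreal (4 * r * c)"
proof -
  have "emeasure weight_measure (vee_ball s r) \<le> ennreal c * emeasure lborel (vee_ball s r)"
    unfolding weight_measure_def using assms(3)
    by (intro emeasure_density_le weight_measurable sets_vee_ball) (auto intro: ennreal_leI)
  also have "\<dots> \<le> ennreal c * ennreal (4 * r)"
    by (intro mult_left_mono emeasure_lborel_vee_ball_le assms) auto
  also have "\<dots> = ennreal (4 * r * c)"
    using assms by (simp add: mult.commute flip: ennreal_mult)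
  finally show ?thesis .
qed

lemma emeasure_vee_ball_ge:
  assumes "a \<le> b" "c \<ge> 0" "{a<..<b} \<subseteq> vee_ball s r" "\<And>t. a < t \<Longrightarrow> t < b \<Longrightarrow> c \<le> weight t"
  shows "ennreal (c * (b - a)) \<le> emeasure weight_measure (vee_ball s r)"
proof -
  have "ennreal (c * (b - a)) = ennreal c * emeasure lborel {a<..<b}"
    using assms by (simp add: ennreal_mult)
  also have "\<dots> \<le> emeasure weight_measure {a<..<b}"
    unfolding weight_measure_def using assms(4)
    by (intro emeasure_density_ge weight_measurable) (auto intro: ennreal_leI)
  also have "\<dots> \<le> emeasure weight_measure (vee_ball s r)"
    using assms(3) sets_vee_ball by (intro emeasure_mono) (auto simp: weight_measure_def)
  finally show ?thesis .
qed

lemma small_vee_ball_le: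
  assumes "0 < r" "r \<le> 2"
  shows "emeasure weight_measure (vee_ball s r) \<le> ennreal (4 * r * (exp 3 * weight s))"
  using assms weight_pos[of s] weight_le_near by (intro emeasure_vee_ball_le) auto

lemma small_vee_ball_ge:
  assumes "0 < r" "r \<le> 2"
  shows "ennreal (r * exp (-2) * weight s) \<le> emeasure weight_measure (vee_ball s r)"
proof -
  \<comment> \<open>Over a parameter interval of length \<open>r \<le> 2\<close> ending at
    \<open>s\<close>, the weight falls by a factor of at most \<open>exp 2\<close>.\<close>
  have "exp (-2) * weight s \<le> weight t" if "s - r < t" "t < s" for t
  proof -
    have "exp (-2) * weight s \<le> exp (-2) * (exp \<bar>t - s\<bar> * weight t)"
      by (intro mult_left_mono weight_le_exp) auto
    also have "\<dots> = exp (\<bar>t - s\<bar> - 2) * weight t" by (simp add: exp_diff exp_minus field_simps)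
    also have "\<dots> \<le> 1 * weight t"
      using that assms weight_pos[of t] by (intro mult_right_mono) auto
    finally show ?thesis by simp
  qed
  moreover have "{s - r<..<s} \<subseteq> vee_ball s r"
  proof
    fix t assume "t \<in> {s - r<..<s}"
    then show "t \<in> vee_ball s r" using linf_dist_vee_le[of s t] by (auto simp: vee_ball_def)
  qed
  ultimately have "ennreal (exp (-2) * weight s * (s - (s - r))) \<le> emeasure weight_measure (vee_ball s r)"
    using assms weight_pos[of s] by (intro emeasure_vee_ball_ge) auto
  then show ?thesis by (simp add: mult_ac)
qed

lemma vee_ball_le:
  assumes "0 < r"
  shows "emeasure weight_measure (vee_ball s r) \<le> ennreal (4 * r)"
  using emeasure_vee_ball_le[of r 1 s] assms weight_le_1 by simp

lemma large_vee_ball_ge: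
  assumes "2 < r"
  shows "ennreal r \<le> emeasure weight_measure (vee_ball s r)"
proof -
  \<comment> \<open>This interval lies on the right arm, where the weight is 1, even when the centre
    is on the left arm.\<close>
  have "{\<bar>s\<bar><..<\<bar>s\<bar> + r} \<subseteq> vee_ball s r"
    using assms by (auto simp: vee_ball_def linf_dist_vee_large)
  then have "ennreal (1 * (\<bar>s\<bar> + r - \<bar>s\<bar>)) \<le> emeasure weight_measure (vee_ball s r)"
    using assms by (intro emeasure_vee_ball_ge) (auto simp: weight_def)
  then show ?thesis by simp
qed

section \<open>Metric measure space structure\<close>

lemma vee_metric_measure_space: "metric_measure_space (range vee) linf_dist vee_measure"
proof unfold_locales
  show "emeasure vee_measure (range vee) \<noteq> 0"
  proof
    assume "emeasure vee_measure (range vee) = 0"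
    moreover have "emeasure vee_measure (vee.mball (vee 0) 3) \<le> emeasure vee_measure (range vee)"
      by (metis emeasure_space space_vee_measure)
    ultimately show False
      using large_vee_ball_ge[of 3 0] by (simp add: emeasure_mball_vee)
  qed
  show "emeasure vee_measure (vee.mball x r) < \<infinity>" if "x \<in> range vee" "r > 0" for x r
    using that vee_ball_le[of r, THEN le_less_trans] by (auto simp: emeasure_mball_vee)
  show "emeasure vee_measure (\<Union>\<U>) = (SUP \<F> \<in> {\<F>. \<F> \<subseteq> \<U> \<and> finite \<F>}. emeasure vee_measure (\<Union>\<F>))"
    if "\<And>U. U \<in> \<U> \<Longrightarrow> openin vee.mtopology U" for \<U>
    by (rule emeasure_Union_open_vimage[where f = vee])
      (use that openin_sets_vee_measure open_vimage_vee openin_subset in fastforce)+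
qed (simp_all add: space_vee_measure sets_vee_measure)

interpretation vee: metric_measure_space "range vee" linf_dist vee_measure
  by (rule vee_metric_measure_space)

section \<open>Arc-connectedness and geometric doubling\<close>

lemma vee_arc_connected: "vee.arc_connected"
  unfolding vee.arc_connected_def
proof (intro ballI impI)
  fix x y assume "x \<in> range vee" "y \<in> range vee" "x \<noteq> y"
  then obtain a b where xy: "x = vee a" "y = vee b" and "a \<noteq> b" by blast
  define g where "g u = vee (a + u * (b - a))" for u
  have "continuous_map (top_of_set {0..1}) vee.mtopology g"
    unfolding vee.continuous_map_to_metric
  proof (intro ballI allI impI)
    fix u \<epsilon> :: real assume u: "u \<in> topspace (top_of_set {0..1})" and "\<epsilon> > 0"
    \<comment> \<open>The path is \<open>\<bar>b - a\<bar>\<close>-Lipschitz, which dictates this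
      radius.\<close>
    let ?U = "{0..1} \<inter> ball u (\<epsilon> / \<bar>b - a\<bar>)"
    have "g v \<in> vee.mball (g u) \<epsilon>" if "v \<in> ?U" for v
    proof -
      have "linf_dist (g u) (g v) \<le> \<bar>(u - v) * (b - a)\<bar>"
        using linf_dist_vee_le[of "a + u * (b - a)" "a + v * (b - a)"]
        by (simp add: g_def algebra_simps)
      also have "\<dots> < \<epsilon>"
        using that \<open>a \<noteq> b\<close> by (simp add: dist_real_def abs_mult pos_less_divide_eq)
      finally show ?thesis by (simp add: g_def)
    qed
    then show "\<exists>U. openin (top_of_set {0..1}) U \<and> u \<in> U \<and> (\<forall>v\<in>U. g v \<in> vee.mball (g u) \<epsilon>)"
      using u \<open>\<epsilon> > 0\<close> \<open>a \<noteq> b\<close> by (intro exI[of _ ?U]) (auto intro: openin_open_Int)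
  qed
  moreover have "inj_on g (topspace (top_of_set {0..1}))"
    using \<open>a \<noteq> b\<close> by (auto simp: g_def inj_on_def dest!: injD[OF inj_vee])
  \<comment> \<open>A continuous injection from a compact space into a Hausdorff space is an
    embedding.\<close>
  ultimately have "embedding_map (top_of_set {0..1}) vee.mtopology g"
    using vee.Hausdorff_space_mtopology
    by (intro continuous_imp_embedding_map) (auto simp: compact_space_subtopology)
  then show "\<exists>g. embedding_map (top_of_set {0..1::real}) vee.mtopology g \<and> g 0 = x \<and> g 1 = y"
    by (intro exI[of _ g]) (auto simp: g_def xy)
qed

lemma vee_geometrically_doubling: "vee.geometrically_doubling"
  unfolding vee.geometrically_doubling_def
proof (intro exI[of _ 18] conjI ballI allI impI)
  fix x and r :: real assume "x \<in> range vee" "r > 0"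
  then obtain s where s: "x = vee s" by blast
  \<comment> \<open>Centres form a grid of mesh \<open>r / 4\<close> in height: nine heights on each
    of two arms, hence 18. If \<open>\<bar>s\<bar> + of_int k * (r / 4)\<close> is negative the
    centre falls on the other arm, which is harmless because distances are estimated through the
    parameter.\<close>
  define C where "C = (\<lambda>(\<sigma>, k). vee (\<sigma> * (\<bar>s\<bar> + of_int k * (r / 4)))) ` ({1, -1} \<times> {-4..4})"
  have "card C \<le> card ({1, -1 :: real} \<times> {-4..4 :: int})"
    unfolding C_def by (intro card_image_le) auto
  then have "card C \<le> 18" by (simp add: card_cartesian_product)
  moreover have "vee.mball x r \<subseteq> (\<Union>c\<in>C. vee.mball c (r / 2))"
  proof
    fix y assume y: "y \<in> vee.mball x r"
    then obtain t where t: "y = vee t" by auto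
    \<comment> \<open>Rounding the height of \<open>y\<close> down to the grid errs by less than
      \<open>r / 4\<close>; \<open>\<sigma>\<close> records the arm of \<open>y\<close>.\<close>
    define k where "k = \<lfloor>(\<bar>t\<bar> - \<bar>s\<bar>) / (r / 4)\<rfloor>"
    define \<sigma> :: real where "\<sigma> = (if t \<ge> 0 then 1 else -1)"
    let ?c = "\<sigma> * (\<bar>s\<bar> + of_int k * (r / 4))"
    have "\<bar>\<bar>s\<bar> - \<bar>t\<bar>\<bar> < r" using y linf_dist_vee_ge[of s t] by (auto simp: s t)
    then have "-4 \<le> (\<bar>t\<bar> - \<bar>s\<bar>) / (r / 4)" "(\<bar>t\<bar> - \<bar>s\<bar>) / (r / 4) < 4"
      using \<open>r > 0\<close> by (auto simp: field_simps)
    then have "k \<in> {-4..4}" unfolding k_def by (auto simp: le_floor_iff floor_le_iff)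
    then have center: "vee ?c \<in> C" unfolding C_def \<sigma>_def by force
    have "of_int k \<le> (\<bar>t\<bar> - \<bar>s\<bar>) / (r / 4)" "(\<bar>t\<bar> - \<bar>s\<bar>) / (r / 4) < of_int k + 1"
      unfolding k_def by linarith+
    then have "of_int k * (r / 4) \<le> \<bar>t\<bar> - \<bar>s\<bar>" "\<bar>t\<bar> - \<bar>s\<bar> < of_int k * (r / 4) + r / 4"
      using \<open>r > 0\<close> by (auto simp: field_simps)
    then have "\<bar>\<bar>s\<bar> + of_int k * (r / 4) - \<bar>t\<bar>\<bar> < r / 2" using \<open>r > 0\<close> by linarith
    moreover have "?c - t = \<sigma> * (\<bar>s\<bar> + of_int k * (r / 4) - \<bar>t\<bar>)" "\<bar>\<sigma>\<bar> = 1"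
      by (auto simp: \<sigma>_def algebra_simps)
    ultimately have "\<bar>?c - t\<bar> < r / 2" by (simp only: abs_mult mult_1)
    then have "y \<in> vee.mball (vee ?c) (r / 2)"
      using linf_dist_vee_le[of ?c t] by (simp add: t)
    with center show "y \<in> (\<Union>c\<in>C. vee.mball c (r / 2))" by blast
  qed
  ultimately show "\<exists>C\<subseteq>range vee. finite C \<and> card C \<le> 18 \<and> vee.mball x r \<subseteq> (\<Union>c\<in>C. vee.mball c (r / 2))"
    by (intro exI[of _ C]) (auto simp: C_def)
qed simp

section \<open>Local comparability and failure of doubling\<close>

lemma vee_local_comparability: "vee.local_comparability"
  unfolding vee.local_comparability_def
\<comment> \<open>For \<open>r \<le> 2\<close> the upper bound on one ball costs
  \<open>4 * exp 3\<close>, exchanging \<open>weight s\<close> for \<open>weight t\<close> costs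
  \<open>exp 3\<close>, and the lower bound on the other costs \<open>exp 2\<close>. For
  \<open>r > 2\<close> both measures lie above \<open>r\<close> and below \<open>4 * r\<close>, so a
  factor 4 suffices.\<close>
proof (intro exI[of _ "4 * exp 8"] conjI ballI allI impI)
  have "1 \<le> exp (8::real)" by simp
  then show "1 \<le> 4 * exp (8::real)" by linarith
  fix r x y assume r: "(0::real) < r" and "x \<in> range vee" "y \<in> range vee" and xy: "linf_dist x y < r"
  then obtain s t where st: "x = vee s" "y = vee t" by blast
  have "emeasure weight_measure (vee_ball s r) \<le> ennreal (4 * exp 8) * emeasure weight_measure (vee_ball t r)"
  proof (cases "r \<le> 2")
    case True
    have "s \<in> vee_ball t r" using xy by (simp add: vee_ball_def st vee.commute)
    then have "weight s \<le> exp 3 * weight t" using True by (rule weight_le_near)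
    then have "4 * r * (exp 3 * weight s) \<le> 4 * r * (exp 3 * (exp 3 * weight t))"
      using r by (intro mult_left_mono) auto
    also have "\<dots> = 4 * exp 8 * (r * exp (-2) * weight t)"
    proof -
      have "exp 3 * exp 3 = exp 8 * exp (-2 :: real)" by (simp flip: exp_add)
      then show ?thesis by (metis (no_types, opaque_lifting) mult.assoc mult.commute)
    qed
    finally have le: "4 * r * (exp 3 * weight s) \<le> 4 * exp 8 * (r * exp (-2) * weight t)" .
    have "emeasure weight_measure (vee_ball s r) \<le> ennreal (4 * r * (exp 3 * weight s))"
      using r True by (rule small_vee_ball_le)
    also have "\<dots> \<le> ennreal (4 * exp 8 * (r * exp (-2) * weight t))"
      by (rule ennreal_leI[OF le])
    also have "\<dots> = ennreal (4 * exp 8) * ennreal (r * exp (-2) * weight t)"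
      using r weight_pos[of t] by (intro ennreal_mult) auto
    also have "\<dots> \<le> ennreal (4 * exp 8) * emeasure weight_measure (vee_ball t r)"
      by (intro mult_left_mono small_vee_ball_ge r True) auto
    finally show ?thesis .
  next
    case False
    have "emeasure weight_measure (vee_ball s r) \<le> ennreal (4 * r)"
      using r by (rule vee_ball_le)
    also have "\<dots> \<le> ennreal (4 * exp 8 * r)"
      using r by (intro ennreal_leI) auto
    also have "\<dots> = ennreal (4 * exp 8) * ennreal r"
      using r by (intro ennreal_mult) auto
    also have "\<dots> \<le> ennreal (4 * exp 8) * emeasure weight_measure (vee_ball t r)"
      using False by (intro mult_left_mono large_vee_ball_ge) auto
    finally show ?thesis .
  qed
  then show "emeasure vee_measure (vee.mball x r) \<le> ennreal (4 * exp 8) * emeasure vee_measure (vee.mball y r)"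
    by (simp only: st emeasure_mball_vee)
qed

lemma vee_not_doubling: "\<not> vee.doubling"
proof
  assume "vee.doubling"
  then obtain C :: real where C: "C > 0" and doubling: "\<And>r x. r > 0 \<Longrightarrow> x \<in> range vee \<Longrightarrow>
      emeasure vee_measure (vee.mball x (2 * r)) \<le> ennreal C * emeasure vee_measure (vee.mball x r)"
    unfolding vee.doubling_def by blast
  \<comment> \<open>The summand \<open>-3\<close> cancels the factor \<open>exp 3\<close> of the
    small-ball bound, leaving \<open>exp (- (2 * C))\<close>. Doubling from radius 2 to 4 then
    forces \<open>4 \<le> 8 * C * exp (- (2 * C))\<close>, against \<open>1 + x \<le> exp x\<close>
    at \<open>x = 2 * C\<close>.\<close>
  define s where "s = - 3 - 2 * C"
  have "ennreal 4 \<le> emeasure weight_measure (vee_ball s 4)"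
    by (rule large_vee_ball_ge) simp
  also have "\<dots> \<le> ennreal C * emeasure weight_measure (vee_ball s 2)"
    using doubling[of 2 "vee s"] by (simp add: emeasure_mball_vee)
  also have "\<dots> \<le> ennreal C * ennreal (4 * 2 * (exp 3 * weight s))"
    by (intro mult_left_mono small_vee_ball_le) auto
  also have "\<dots> = ennreal (C * (4 * 2 * (exp 3 * weight s)))"
    using C weight_pos[of s] by (intro ennreal_mult[symmetric]) auto
  finally have "4 \<le> C * (4 * 2 * (exp 3 * weight s))"
    using C weight_pos[of s] by (subst (asm) ennreal_le_iff) auto
  also have "exp 3 * weight s = exp (- (2 * C))"
    using C by (simp add: weight_def s_def flip: exp_add)
  finally have "exp (2 * C) \<le> 2 * C" by (simp add: exp_minus field_simps)
  with exp_ge_add_one_self[of "2 * C"] show False by linarith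
qed

theorem theorem5p9:
  shows "\<exists>(X :: (real \<times> real) set) (\<mu> :: (real \<times> real) measure).
    metric_measure_space X linf_dist \<mu> \<and>
    Metric_space.arc_connected X linf_dist \<and>
    Metric_space.geometrically_doubling X linf_dist \<and>
    metric_measure_space.local_comparability X linf_dist \<mu> \<and>
    \<not> metric_measure_space.doubling X linf_dist \<mu>"
  using vee_metric_measure_space vee_arc_connected vee_geometrically_doubling
    vee_local_comparability vee_not_doubling by blast

end
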